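(* Let $\mathcal{K}$ be a unital associative algebra over $\mathbb{C}$ (not necessarily commutative), let $M$ be an $n\times n$ Manin matrix over $\mathcal{K}$, let $k<n$, and let $X$ be a $k\times(n-k)$ matrix with arbitrary entries in $\mathcal{K}$ (not required to commute with the entries of $M$ or with each other). Then $$\det{}^{col}\left(M\begin{pmatrix}1_{k\times k}& X\\ 0_{(n-k)\times k}&1_{(n-k)\times(n-k)}\end{pmatrix}\right)=\det{}^{col}(M).$$
   Context: A (possibly rectangular) matrix $M=(M_{ij})$ with entries in an associative ring $\mathcal{K}$ is called a Manin matrix if (1) entries lying in the same column commute with each other, and (2) $[M_{ij},M_{kl}]=[M_{kj},M_{il}]$ for all $i,j,k,l$, where $[a,b]=ab-ba$. For any $n\times n$ matrix $X$ over $\mathcal{K}$, $\det^{col}(X)=\sum_{\sigma\in S_n}\operatorname{sgn}(\sigma)\,X_{\sigma(1)1}X_{\sigma(2)2}\cdots X_{\sigma(n)n}$. *)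

theory Defs
  imports "HOL-Combinatorics.Permutations" "Jordan_Normal_Form.Matrix"
begin

(* The sort {ring, monoid_mult} rather than ring_1, which would exclude the zero algebra. *)
locale unital_complex_algebra = vector_space scale
  for scale :: "complex \<Rightarrow> 'a::{ring, monoid_mult} \<Rightarrow> 'a" +
  assumes scale_mult_left: "scale c x * y = scale c (x * y)"
    and scale_mult_right: "x * scale c y = scale c (x * y)"

definition commutator :: "'a::ring \<Rightarrow> 'a \<Rightarrow> 'a" where
  "commutator a b = a * b - b * a"

definition manin_matrix :: "'a::ring mat \<Rightarrow> bool" where
  "manin_matrix M \<longleftrightarrow>
     (\<forall>i<dim_row M. \<forall>k<dim_row M. \<forall>j<dim_col M.
        M $$ (i, j) * M $$ (k, j) = M $$ (k, j) * M $$ (i, j)) \<and>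
     (\<forall>i<dim_row M. \<forall>k<dim_row M. \<forall>j<dim_col M. \<forall>l<dim_col M.
        commutator (M $$ (i, j)) (M $$ (k, l)) = commutator (M $$ (k, j)) (M $$ (i, l)))"

(* Meant for square matrices.  The entries need not commute, so each product is
   taken over the list of columns in increasing order. The sign is applied by
   negation because of_int is available only in ring_1. *)
definition det_col :: "'a::{ring, monoid_mult} mat \<Rightarrow> 'a" where
  "det_col A =
     (\<Sum>\<sigma> | \<sigma> permutes {..<dim_col A}.
        let p = prod_list (map (\<lambda>j. A $$ (\<sigma> j, j)) [0..<dim_col A])
        in if evenperm \<sigma> then p else - p)"

end

theory Submission
  imports Defs
begin

text \<open>
  Replace the modified columns by the columns of \<open>M\<close> one at a time, from left to right.  When
  column \<open>t\<close> is replaced, the determinant changes by a sum of determinants whose first \<open>t\<close>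
  columns are those of \<open>M\<close> and whose column \<open>t\<close> is an earlier column of \<open>M\<close>, multiplied on the
  right by an entry of \<open>X\<close>.  The Manin relations make the column determinant change sign when two
  adjacent columns of \<open>M\<close> are interchanged, so the repeated column can be moved next to column
  \<open>t\<close>, where the two copies cancel because entries of one column commute.  The right factor is
  harmless since only columns to its left are moved.
\<close>

text \<open>The column index is the first argument of \<open>G\<close>, so that replacing a column
  is a function update and permuting columns is composition on the right.\<close>

definition column_prod :: "nat \<Rightarrow> (nat \<Rightarrow> nat \<Rightarrow> 'a::monoid_mult) \<Rightarrow> (nat \<Rightarrow> nat) \<Rightarrow> 'a" where
  "column_prod n G \<sigma> = prod_list (map (\<lambda>j. G j (\<sigma> j)) [0..<n])"

definition column_alt_sum :: "nat \<Rightarrow> (nat \<Rightarrow> nat \<Rightarrow> 'a::{ring, monoid_mult}) \<Rightarrow> 'a" where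
  "column_alt_sum n G =
     (\<Sum>\<sigma> | \<sigma> permutes {..<n}.
        if evenperm \<sigma> then column_prod n G \<sigma> else - column_prod n G \<sigma>)"

lemma det_col_eq_column_alt_sum:
  "det_col A = column_alt_sum (dim_col A) (\<lambda>j i. A $$ (i, j))"
  unfolding det_col_def column_alt_sum_def column_prod_def Let_def ..

lemma column_alt_sum_cong:
  assumes "\<And>j i. j < n \<Longrightarrow> i < n \<Longrightarrow> G j i = H j i"
  shows "column_alt_sum n G = column_alt_sum n H"
proof -
  have "column_prod n G \<sigma> = column_prod n H \<sigma>" if "\<sigma> permutes {..<n}" for \<sigma>
    unfolding column_prod_def
    using assms permutes_in_image[OF that]
    by (intro arg_cong[where f = prod_list] map_cong) auto
  then show ?thesis
    unfolding column_alt_sum_def by (intro sum.cong) auto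
qed

lemma column_prod_split:
  assumes "m < n"
  shows "column_prod n G \<sigma> =
    column_prod m G \<sigma> * G m (\<sigma> m) * prod_list (map (\<lambda>j. G j (\<sigma> j)) [Suc m..<n])"
proof -
  have "[0..<n] = [0..<m] @ m # [Suc m..<n]"
    using assms upt_add_eq_append[of 0 m "n - m"] by (simp add: upt_conv_Cons)
  then show ?thesis
    by (simp add: column_prod_def mult.assoc)
qed

lemma column_alt_sum_add:
  assumes "m < n"
  shows "column_alt_sum n (G(m := \<lambda>i. u i + v i)) =
    column_alt_sum n (G(m := u)) + column_alt_sum n (G(m := v))"
proof -
  have upd: "map (\<lambda>j. (G(m := w)) j (\<sigma> j)) [Suc m..<n] = map (\<lambda>j. G j (\<sigma> j)) [Suc m..<n]"
    "column_prod m (G(m := w)) \<sigma> = column_prod m G \<sigma>" for w \<sigma>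
    by (auto simp: column_prod_def intro!: arg_cong[where f = prod_list])
  have "column_prod n (G(m := \<lambda>i. u i + v i)) \<sigma> =
      column_prod n (G(m := u)) \<sigma> + column_prod n (G(m := v)) \<sigma>" for \<sigma>
    unfolding column_prod_split[OF assms] upd by (simp add: algebra_simps)
  then show ?thesis
    unfolding column_alt_sum_def sum.distrib[symmetric] by (intro sum.cong) auto
qed

lemma column_alt_sum_sum:
  assumes "m < n" and "finite I"
  shows "column_alt_sum n (G(m := \<lambda>i. u i + (\<Sum>l\<in>I. v l i))) =
    column_alt_sum n (G(m := u)) + (\<Sum>l\<in>I. column_alt_sum n (G(m := v l)))"
  using assms(2)
proof (induction I rule: finite_induct)
  case empty
  then show ?case by simp
next
  case (insert x I)
  have "(\<lambda>i. u i + (\<Sum>l\<in>insert x I. v l i)) = (\<lambda>i. v x i + (u i + (\<Sum>l\<in>I. v l i)))"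
    using insert by (auto simp: algebra_simps)
  then show ?case
    using insert
    by (simp add: column_alt_sum_add[OF assms(1)] add.left_commute del: fun_upd_apply)
qed

text \<open>Composition with a transposition is an involution that exchanges even and odd
  permutations, so every odd term can be charged to a unique even one.\<close>

lemma sum_permutes_pair_transpose:
  fixes f :: "('b \<Rightarrow> 'b) \<Rightarrow> 'a::ab_group_add"
  assumes "finite S" "p \<in> S" "q \<in> S" "p \<noteq> q"
  shows "(\<Sum>\<sigma> | \<sigma> permutes S. if evenperm \<sigma> then f \<sigma> else - f \<sigma>) =
    (\<Sum>\<sigma> | \<sigma> permutes S \<and> evenperm \<sigma>. f \<sigma> - f (\<sigma> \<circ> transpose p q))"
proof -
  let ?E = "{\<sigma>. \<sigma> permutes S \<and> evenperm \<sigma>}" and ?O = "{\<sigma>. \<sigma> permutes S \<and> \<not> evenperm \<sigma>}"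
  let ?t = "\<lambda>\<sigma>. \<sigma> \<circ> transpose p q"
  have t: "transpose p q permutes S"
    using assms by (simp add: permutes_swap_id)
  have even_t: "evenperm (?t \<sigma>) \<longleftrightarrow> \<not> evenperm \<sigma>" if "\<sigma> permutes S" for \<sigma>
    using that assms t
    by (subst evenperm_comp) (auto intro: permutation_permutes[THEN iffD2] simp: evenperm_swap)
  have fin: "finite ?E" "finite ?O"
    using finite_permutations[OF assms(1)] by (auto intro: finite_subset[rotated])
  have split: "{\<sigma>. \<sigma> permutes S} = ?E \<union> ?O" "?E \<inter> ?O = {}" by auto
  have bij: "(\<Sum>\<sigma>\<in>?E. f (?t \<sigma>)) = (\<Sum>\<sigma>\<in>?O. f \<sigma>)"
  proof (rule sum.reindex_bij_witness[where i = ?t and j = ?t])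
  qed (use t even_t in \<open>auto simp: comp_assoc intro: permutes_compose\<close>)
  show ?thesis
    unfolding sum_subtractf bij split(1) sum.union_disjoint[OF fin split(2)]
    by (simp add: sum_negf)
qed

lemma column_prod_two:
  assumes "Suc p < n"
  shows "column_prod n G \<sigma> = column_prod p G \<sigma> * (G p (\<sigma> p) * G (Suc p) (\<sigma> (Suc p))) *
    prod_list (map (\<lambda>j. G j (\<sigma> j)) [Suc (Suc p)..<n])"
  by (simp add: column_prod_split[OF assms] column_prod_split[of p "Suc p"] mult.assoc)

lemma column_prod_two_transpose:
  assumes "Suc p < n"
  shows "column_prod n G (\<sigma> \<circ> transpose p (Suc p)) =
    column_prod p G \<sigma> * (G p (\<sigma> (Suc p)) * G (Suc p) (\<sigma> p)) *
    prod_list (map (\<lambda>j. G j (\<sigma> j)) [Suc (Suc p)..<n])"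
proof -
  have "column_prod p G (\<sigma> \<circ> transpose p (Suc p)) = column_prod p G \<sigma>"
    by (auto simp: column_prod_def transpose_def intro!: arg_cong[where f = prod_list])
  moreover have "map (\<lambda>j. G j ((\<sigma> \<circ> transpose p (Suc p)) j)) [Suc (Suc p)..<n] =
      map (\<lambda>j. G j (\<sigma> j)) [Suc (Suc p)..<n]"
    by (auto simp: transpose_def)
  ultimately show ?thesis
    unfolding column_prod_two[OF assms]
    by (simp only: comp_apply transpose_apply_first transpose_apply_second)
qed

text \<open>The terms of \<open>\<sigma>\<close> and
  \<open>\<sigma> \<circ> transpose p (Suc p)\<close> differ only in two neighbouring factors. The
  common factors to the left and right can therefore be pulled out, which leaves a 2 by 2 column
  minor in the middle.\<close>

lemma column_alt_sum_adjacent: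
  assumes "Suc p < n"
  shows "column_alt_sum n G = (\<Sum>\<sigma> | \<sigma> permutes {..<n} \<and> evenperm \<sigma>.
    column_prod p G \<sigma> *
    (G p (\<sigma> p) * G (Suc p) (\<sigma> (Suc p)) - G p (\<sigma> (Suc p)) * G (Suc p) (\<sigma> p)) *
    prod_list (map (\<lambda>j. G j (\<sigma> j)) [Suc (Suc p)..<n]))"
proof -
  have "column_alt_sum n G = (\<Sum>\<sigma> | \<sigma> permutes {..<n} \<and> evenperm \<sigma>.
      column_prod n G \<sigma> - column_prod n G (\<sigma> \<circ> transpose p (Suc p)))"
    unfolding column_alt_sum_def
    using assms by (intro sum_permutes_pair_transpose) auto
  then show ?thesis
    by (simp only: column_prod_two_transpose[OF assms])
      (simp only: column_prod_two[OF assms] right_diff_distrib left_diff_distrib)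
qed

text \<open>Here every middle minor vanishes. The condition \<open>comm\<close> is a relation
  between the two columns rather than their equality, so that it also covers a column with commuting
  entries followed by the same column times a right factor.\<close>

lemma column_alt_sum_adjacent_zero:
  assumes "Suc p < n"
    and comm: "\<And>r s. r < n \<Longrightarrow> s < n \<Longrightarrow> G p r * G (Suc p) s = G p s * G (Suc p) r"
  shows "column_alt_sum n G = 0"
proof -
  have "G p (\<sigma> p) * G (Suc p) (\<sigma> (Suc p)) = G p (\<sigma> (Suc p)) * G (Suc p) (\<sigma> p)"
    if "\<sigma> permutes {..<n}" for \<sigma>
    using permutes_in_image[OF that] assms(1) by (intro comm) auto
  then show ?thesis
    unfolding column_alt_sum_adjacent[OF assms(1)] by (intro sum.neutral) auto
qed

text \<open>For columns a and b, the relation [a_r, b_s] = [a_s, b_r] rearranges to a_r b_s - a_s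
  b_r = -(b_r a_s - b_s a_r), so each middle minor changes sign when a and b are
  interchanged.\<close>

lemma column_alt_sum_adjacent_swap:
  assumes "Suc p < n"
    and manin: "\<And>r s. r < n \<Longrightarrow> s < n \<Longrightarrow>
      commutator (G p r) (G (Suc p) s) = commutator (G p s) (G (Suc p) r)"
  shows "column_alt_sum n (G \<circ> transpose p (Suc p)) = - column_alt_sum n G"
proof -
  let ?H = "G \<circ> transpose p (Suc p)"
  have pre: "column_prod p ?H \<sigma> = column_prod p G \<sigma>" for \<sigma>
    by (auto simp: column_prod_def transpose_def intro!: arg_cong[where f = prod_list])
  have post: "map (\<lambda>j. ?H j (\<sigma> j)) [Suc (Suc p)..<n] = map (\<lambda>j. G j (\<sigma> j)) [Suc (Suc p)..<n]"
    for \<sigma>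
    by (auto simp: transpose_def)
  have mid: "?H p (\<sigma> p) * ?H (Suc p) (\<sigma> (Suc p)) - ?H p (\<sigma> (Suc p)) * ?H (Suc p) (\<sigma> p) =
      - (G p (\<sigma> p) * G (Suc p) (\<sigma> (Suc p)) - G p (\<sigma> (Suc p)) * G (Suc p) (\<sigma> p))"
    if "\<sigma> permutes {..<n}" for \<sigma>
    using manin[of "\<sigma> p" "\<sigma> (Suc p)"] permutes_in_image[OF that] assms(1)
    by (auto simp: commutator_def algebra_simps)
  show ?thesis
    unfolding column_alt_sum_adjacent[OF assms(1)] pre post sum_negf[symmetric]
    by (intro sum.cong refl) (simp only: mem_Collect_eq mid mult_minus_left mult_minus_right)
qed

text \<open>Induction on the distance \<open>m - p\<close>. The map \<open>c\<close> records which
  column of \<open>M\<close> stands at each position before \<open>m\<close>; it is arbitrary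
  because the swaps of the induction reorder these columns.\<close>

lemma column_alt_sum_repeated:
  assumes "manin_matrix M" "M \<in> carrier_mat n n"
    and "p < m" "m < n"
    and "\<And>j. j < m \<Longrightarrow> c j < n"
    and "\<And>j i. j < m \<Longrightarrow> i < n \<Longrightarrow> G j i = M $$ (i, c j)"
    and "\<And>i. i < n \<Longrightarrow> G m i = M $$ (i, c p) * x"
  shows "column_alt_sum n G = 0"
  using assms(3-)
proof (induction "m - p" arbitrary: p c G)
  case 0
  then show ?case by simp
next
  case (Suc d)
  show ?case
  proof (cases "m = Suc p")
    case True
    have "M $$ (r, c p) * M $$ (s, c p) = M $$ (s, c p) * M $$ (r, c p)" if "r < n" "s < n" for r s
      using assms(1,2) Suc.prems(1,3) that unfolding manin_matrix_def by auto
    then show ?thesis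
      using Suc.prems True
      \<comment> \<open>Reassociating puts \<open>x\<close> at the far right and brings the two
        commuting entries of column \<open>c p\<close> together.\<close>
      by (intro column_alt_sum_adjacent_zero[of p]) (auto simp flip: mult.assoc)
  next
    case False
    then have p: "Suc p < m" using Suc.prems by simp
    let ?t = "transpose p (Suc p)"
    have "column_alt_sum n (G \<circ> ?t) = 0"
    \<comment> \<open>The swap moves the repeated column from position \<open>p\<close> to
      \<open>Suc p\<close>, one step closer to \<open>m\<close>; column \<open>m\<close> stays in
      place because \<open>Suc p < m\<close>.\<close>
    proof (rule Suc.hyps(1)[of "Suc p" "c \<circ> ?t"])
      have t: "?t j < m" if "j < m" for j
        using that p by (auto simp: transpose_def)
      show "(c \<circ> ?t) j < n" if "j < m" for j
        using Suc.prems(3) t[OF that] by simp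
      show "(G \<circ> ?t) j i = M $$ (i, (c \<circ> ?t) j)" if "j < m" "i < n" for j i
        using Suc.prems(4) t[OF that(1)] that by simp
      show "(G \<circ> ?t) m i = M $$ (i, (c \<circ> ?t) (Suc p)) * x" if "i < n" for i
        using Suc.prems(5) p that by (simp add: transpose_def)
    qed (use Suc.hyps(2) p \<open>m < n\<close> in auto)
    moreover have "column_alt_sum n (G \<circ> ?t) = - column_alt_sum n G"
    proof (rule column_alt_sum_adjacent_swap)
      show "commutator (G p r) (G (Suc p) s) = commutator (G p s) (G (Suc p) r)"
        if "r < n" "s < n" for r s
        using assms(1,2) Suc.prems(3)[of p] Suc.prems(3)[of "Suc p"] p that
        unfolding manin_matrix_def by (auto simp: Suc.prems(4))
    qed (use p \<open>m < n\<close> in simp)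
    ultimately show ?thesis by simp
  qed
qed

lemma mult_four_block_unipotent_index:
  fixes M X :: "'a::{ring, monoid_mult} mat"
  assumes "M \<in> carrier_mat n n" "X \<in> carrier_mat k (n - k)" "k < n" "i < n" "j < n"
  shows "(M * four_block_mat (1\<^sub>m k) X (0\<^sub>m (n - k) k) (1\<^sub>m (n - k))) $$ (i, j) =
    M $$ (i, j) + (if j < k then 0 else \<Sum>l<k. M $$ (i, l) * X $$ (l, j - k))"
    (is "(M * ?B) $$ _ = _")
proof -
  have "(M * ?B) $$ (i, j) = (\<Sum>l<n. M $$ (i, l) * ?B $$ (l, j))"
    using assms by (simp add: scalar_prod_def lessThan_atLeast0)
  \<comment> \<open>Column \<open>j\<close> of the block matrix is the \<open>j\<close>-th unit
    vector plus, if \<open>k \<le> j\<close>, column \<open>j - k\<close> of \<open>X\<close>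
    extended by zeros.\<close>
  also have "\<dots> = (\<Sum>l<n. (if l = j then M $$ (i, j) else 0) +
      (if l < k then if j < k then 0 else M $$ (i, l) * X $$ (l, j - k) else 0))"
    using assms by (intro sum.cong refl) auto
  also have "\<dots> = M $$ (i, j) +
      (\<Sum>l<n. if l < k then if j < k then 0 else M $$ (i, l) * X $$ (l, j - k) else 0)"
    using assms by (simp add: sum.distrib)
  also have "(\<Sum>l<n. if l < k then if j < k then 0 else M $$ (i, l) * X $$ (l, j - k) else 0) =
      (\<Sum>l<k. if j < k then 0 else M $$ (i, l) * X $$ (l, j - k))"
    using assms by (intro sum.mono_neutral_cong_right) auto
  finally show ?thesis by auto
qed

theorem proposition8:
  fixes scale :: "complex \<Rightarrow> 'a::{ring, monoid_mult} \<Rightarrow> 'a"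
    and M X :: "'a mat" and n k :: nat
  assumes "unital_complex_algebra scale"
    and "M \<in> carrier_mat n n"
    and "manin_matrix M"
    and "k < n"
    and "X \<in> carrier_mat k (n - k)"
  shows "det_col (M * four_block_mat (1\<^sub>m k) X (0\<^sub>m (n - k) k) (1\<^sub>m (n - k))) = det_col M"
proof -
  let ?B = "four_block_mat (1\<^sub>m k) X (0\<^sub>m (n - k) k) (1\<^sub>m (n - k))"
  \<comment> \<open>\<open>Y j\<close> is column \<open>j\<close> of the product only for
    \<open>k \<le> j\<close>, since \<open>j - k\<close> truncates to 0 below \<open>k\<close>. The
    functions \<open>H t\<close> below are used for \<open>k \<le> t\<close> only, so they never
    reach a smaller \<open>j\<close> in \<open>Y\<close>.\<close>
  define Y where "Y j i = M $$ (i, j) + (\<Sum>l<k. M $$ (i, l) * X $$ (l, j - k))" for j i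
  \<comment> \<open>\<open>H t\<close> interpolates between the product, at \<open>t = k\<close>,
    and \<open>M\<close>, at \<open>t = n\<close>.\<close>
  define H where "H t j = (if j < t then \<lambda>i. M $$ (i, j) else Y j)" for t j
  have step: "column_alt_sum n (H t) = column_alt_sum n (H (Suc t))" if "k \<le> t" "t < n" for t
  proof -
    let ?v = "\<lambda>l i. M $$ (i, l) * X $$ (l, t - k)"
    \<comment> \<open>Writing \<open>H t\<close> as an update of itself exposes column
      \<open>t\<close> as a sum, to which additivity in that column applies.\<close>
    have "H t = (H t)(t := \<lambda>i. M $$ (i, t) + (\<Sum>l<k. ?v l i))"
      by (auto simp: H_def Y_def fun_eq_iff)
    then have "column_alt_sum n (H t) = column_alt_sum n ((H t)(t := \<lambda>i. M $$ (i, t))) +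
        (\<Sum>l<k. column_alt_sum n ((H t)(t := ?v l)))"
      using column_alt_sum_sum[OF \<open>t < n\<close>, of "{..<k}" "H t" "\<lambda>i. M $$ (i, t)" ?v]
      by (simp only: finite_lessThan)
    moreover have "(H t)(t := \<lambda>i. M $$ (i, t)) = H (Suc t)"
      by (auto simp: H_def fun_eq_iff)
    \<comment> \<open>Since \<open>l < k \<le> t\<close>, column \<open>l\<close> of
      \<open>M\<close> already stands at position \<open>l\<close>, and column \<open>t\<close> is
      its right multiple by an entry of \<open>X\<close>. The first \<open>t\<close> columns are in
      their original order, so \<open>c\<close> is the identity.\<close>
    moreover have "column_alt_sum n ((H t)(t := ?v l)) = 0" if "l < k" for l
      using that \<open>k \<le> t\<close> \<open>t < n\<close>
      by (intro column_alt_sum_repeated[OF assms(3,2), of l t "\<lambda>j. j" _ "X $$ (l, t - k)"])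
        (auto simp: H_def)
    ultimately show ?thesis by simp
  qed
  have "det_col (M * ?B) = column_alt_sum n (\<lambda>j i. (M * ?B) $$ (i, j))"
    using assms by (simp add: det_col_eq_column_alt_sum)
  also have "\<dots> = column_alt_sum n (H k)"
    using mult_four_block_unipotent_index[OF assms(2,5,4)]
    by (intro column_alt_sum_cong) (auto simp: H_def Y_def)
  also have "\<dots> = column_alt_sum n (H n)"
  proof -
    have "t \<le> n \<longrightarrow> column_alt_sum n (H k) = column_alt_sum n (H t)" if "k \<le> t" for t
      using that by (induction t rule: dec_induct) (auto simp: step)
    then show ?thesis using assms(4) by simp
  qed
  also have "\<dots> = column_alt_sum n (\<lambda>j i. M $$ (i, j))"
    by (intro column_alt_sum_cong) (auto simp: H_def)
  also have "\<dots> = det_col M"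
    using assms by (simp add: det_col_eq_column_alt_sum)
  finally show ?thesis .
qed

end
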